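(* Fix a sample $i$ and an index $j\in\{1,\ldots,N\}$, and let $\tilde T_i$, $e_{i,j}$, $e'_{i,j}$, $d_{i,j}=e'_{i,j}-e_{i,j}$, $\mathcal L_{\mathrm{sal}}$, $\psi_{i,j}$, $\mathrm{CEff}_{i,j}^{\mathrm{exact}}$ and $a_{i,j}$ be as defined in the context. Let $$\Omega_{i,j}=\{\,e_{i,j}+\alpha\, d_{i,j}:\alpha\in[0,1]\,\}\subset\mathbb R^C$$ be the line segment between $e_{i,j}$ and $e'_{i,j}$. Assume that $\psi_{i,j}$ is twice continuously differentiable on a neighborhood of $\Omega_{i,j}$ and that, for some constant $H_{i,j}$, $$\sup_{v\in\Omega_{i,j}}\big\|\nabla^2\psi_{i,j}(v)\big\|_{\mathrm{op}}\le H_{i,j}.$$ Then the remainder $R_{i,j}:=\mathrm{CEff}_{i,j}^{\mathrm{exact}}-a_{i,j}$ satisfies $$\mathrm{CEff}_{i,j}^{\mathrm{exact}}=a_{i,j}+R_{i,j},\qquad |R_{i,j}|\le\frac{H_{i,j}}{2}\,\|d_{i,j}\|_2^2,$$ and consequently $$\Big|\,\big|\mathrm{CEff}_{i,j}^{\mathrm{exact}}\big|-|a_{i,j}|\,\Big|\le\frac{H_{i,j}}{2}\,\|d_{i,j}\|_2^2.$$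
   Context: Let $C,N,K\ge 1$ be integers. For a sample $i$, let $\tilde T_i=[\,e_{[\mathtt{CLS}]};e_{i,1},\ldots,e_{i,N}\,]\in\mathbb R^{(N+1)\times C}$ be a sequence of vectors in $\mathbb R^C$: a special vector $e_{[\mathtt{CLS}]}$ followed by $N$ "evidence units" $e_{i,1},\ldots,e_{i,N}$. A model (Transformer followed by a classifier) is a function assigning to each sequence $T\in\mathbb R^{(N+1)\times C}$ a logit vector $z(T)=(z_1(T),\ldots,z_K(T))\in\mathbb R^K$. The predicted class $\hat y_i\in\arg\max_k z_k(\tilde T_i)$ is determined once from the sequence $\tilde T_i$ and then held constant (under replacement of units and under differentiation). The saliency objective is $\mathcal L_{\mathrm{sal}}(T)=-z_{\hat y_i}(T)$ for every $T\in\mathbb R^{(N+1)\times C}$. For $j\in\{1,\ldots,N\}$ and $v\in\mathbb R^C$, $\tilde T_i^{(j\leftarrow v)}$ denotes the sequence obtained from $\tilde T_i$ by replacing the unit $e_{i,j}$ with $v$ and leaving all other entries (including $e_{[\mathtt{CLS}]}$) unchanged. Define $\psi_{i,j}:\mathbb R^C\to\mathbb R$ by $\psi_{i,j}(v)=\mathcal L_{\mathrm{sal}}(\tilde T_i^{(j\leftarrow v)})$. Let $e'_{i,j}\in\mathbb R^C$ be a reference vector (the choice used in applications is $e'_{i,j}=\mathbf 0$), and let $d_{i,j}=e'_{i,j}-e_{i,j}$ be the replacement direction. The exact counterfactual effect of unit $j$ is $$\mathrm{CEff}_{i,j}^{\mathrm{exact}}=\mathcal L_{\mathrm{sal}}\big(\tilde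 T_i^{(j\leftarrow e'_{i,j})}\big)-\mathcal L_{\mathrm{sal}}(\tilde T_i)=\psi_{i,j}(e'_{i,j})-\psi_{i,j}(e_{i,j}).$$ The signed first-order term is $$a_{i,j}=\big\langle\nabla_{e_{i,j}}\mathcal L_{\mathrm{sal}}(\tilde T_i),\,d_{i,j}\big\rangle,$$ where $\nabla_{e_{i,j}}\mathcal L_{\mathrm{sal}}(\tilde T_i)=\nabla\psi_{i,j}(e_{i,j})$ and $\langle\cdot,\cdot\rangle$ is the Euclidean inner product on $\mathbb R^C$. $\|\cdot\|_2$ is the Euclidean norm and $\|\cdot\|_{\mathrm{op}}$ the spectral (operator) norm of a matrix. *)

theory Defs
  imports "HOL-Analysis.Analysis"
begin

section \<open>Sequences and saliency\<close>

text \<open>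
  A sequence of \<open>N + 1\<close> vectors is indexed by \<^typ>\<open>'n option\<close>, which has \<open>CARD('n) + 1\<close>
  elements: position \<^const>\<open>None\<close> holds the [CLS] vector and position \<open>Some j\<close> the evidence
  unit \<open>j\<close>.
\<close>

type_synonym ('c, 'n) sequence = "real ^ 'c ^ ('n option)"

definition replace_unit ::
    "('c::finite, 'n::finite) sequence \<Rightarrow> 'n \<Rightarrow> real ^ 'c \<Rightarrow> ('c, 'n) sequence" where
  "replace_unit T j v = (\<chi> m. if m = Some j then v else T $ m)"

lemma replace_unit_self [simp]: "replace_unit T j (T $ Some j) = T"
  by (simp add: replace_unit_def vec_eq_iff)

text \<open>The class \<open>y\<close> is a parameter that does not vary with the sequence \<open>T\<close>.\<close>

definition saliency_loss ::
    "(('c::finite, 'n::finite) sequence \<Rightarrow> real ^ 'k) \<Rightarrow> 'k \<Rightarrow> ('c, 'n) sequence \<Rightarrow> real" where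
  "saliency_loss z y T = - (z T $ y)"

definition unit_loss ::
    "(('c::finite, 'n::finite) sequence \<Rightarrow> real) \<Rightarrow> ('c, 'n) sequence \<Rightarrow> 'n \<Rightarrow> real ^ 'c \<Rightarrow> real" where
  "unit_loss L T j v = L (replace_unit T j v)"

section \<open>Gradient, Hessian and \<open>C\<^sup>2\<close> functions\<close>

text \<open>Meaningful only at points of differentiability, where the gradient is unique.\<close>

definition gradient :: "(real ^ 'c \<Rightarrow> real) \<Rightarrow> real ^ 'c \<Rightarrow> real ^ 'c" where
  "gradient f x = (THE D. GDERIV f x :> D)"

lemma gradient_eqI:
  assumes "GDERIV f x :> D"
  shows "gradient f x = D"
  unfolding gradient_def
proof (rule the_equality)
  show "GDERIV f x :> D" by (rule assms)
next
  fix E assume "GDERIV f x :> E"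
  with assms have "(\<lambda>h. h \<bullet> E) = (\<lambda>h. h \<bullet> D)"
    unfolding gderiv_def by (metis has_derivative_unique)
  then have "h \<bullet> E = h \<bullet> D" for h
    by (rule fun_cong)
  then show "E = D"
    by (metis inner_commute vector_eq_ldot)
qed

lemma differentiable_GDERIV_gradient:
  fixes f :: "real ^ 'c \<Rightarrow> real"
  assumes "f differentiable (at x)"
  shows "GDERIV f x :> gradient f x"
proof -
  obtain f' where f': "(f has_derivative f') (at x)"
    using assms by (auto simp: differentiable_def)
  then have "linear f'" by (rule has_derivative_linear)
  then have "h \<bullet> adjoint f' 1 = f' h" for h
    using adjoint_works[of f' h 1] by simp
  with f' have D: "GDERIV f x :> adjoint f' 1"
    by (simp add: gderiv_def)
  show ?thesis
    unfolding gradient_eqI[OF D] by (rule D)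
qed

text \<open>The entry \<open>hessian f x $ k $ l\<close> is \<open>\<partial>\<^sub>l \<partial>\<^sub>k f x\<close>.\<close>

definition hessian :: "(real ^ 'c \<Rightarrow> real) \<Rightarrow> real ^ 'c \<Rightarrow> real ^ 'c ^ 'c" where
  "hessian f x = jacobian (gradient f) (at x)"

definition spectral_norm :: "real ^ 'm ^ 'n \<Rightarrow> real" where
  "spectral_norm A = onorm ((*v) A)"

text \<open>Continuity of \<open>f\<close> and of \<open>gradient f\<close> follows from their differentiability.\<close>

definition C2_on :: "(real ^ 'c) set \<Rightarrow> (real ^ 'c \<Rightarrow> real) \<Rightarrow> bool" where
  "C2_on U f \<longleftrightarrow> open U \<and>
     (\<forall>x\<in>U. f differentiable (at x)) \<and>
     (\<forall>x\<in>U. gradient f differentiable (at x)) \<and>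
     continuous_on U (hessian f)"

section \<open>Counterfactual effect and its first-order term\<close>

definition replacement_direction ::
    "('c::finite, 'n::finite) sequence \<Rightarrow> 'n \<Rightarrow> real ^ 'c \<Rightarrow> real ^ 'c" where
  "replacement_direction T j e' = e' - T $ Some j"

definition replacement_segment ::
    "('c::finite, 'n::finite) sequence \<Rightarrow> 'n \<Rightarrow> real ^ 'c \<Rightarrow> (real ^ 'c) set" where
  "replacement_segment T j e' =
     {T $ Some j + \<alpha> *\<^sub>R replacement_direction T j e' | \<alpha>. \<alpha> \<in> {0..1}}"

lemma replacement_segment_eq_closed_segment:
  "replacement_segment T j e' = closed_segment (T $ Some j) e'"
proof -
  have "T $ Some j + a *\<^sub>R (e' - T $ Some j) = (1 - a) *\<^sub>R T $ Some j + a *\<^sub>R e'" for a :: real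
    by (simp add: scaleR_diff_left scaleR_diff_right)
  then show ?thesis
    by (simp add: replacement_segment_def replacement_direction_def closed_segment_def)
qed

definition CEff_exact ::
    "(('c::finite, 'n::finite) sequence \<Rightarrow> real) \<Rightarrow> ('c, 'n) sequence \<Rightarrow> 'n \<Rightarrow> real ^ 'c \<Rightarrow> real" where
  "CEff_exact L T j e' = L (replace_unit T j e') - L T"

lemma CEff_exact_eq_unit_loss:
  "CEff_exact L T j e' = unit_loss L T j e' - unit_loss L T j (T $ Some j)"
  by (simp add: CEff_exact_def unit_loss_def)

definition first_order_term ::
    "(('c::finite, 'n::finite) sequence \<Rightarrow> real) \<Rightarrow> ('c, 'n) sequence \<Rightarrow> 'n \<Rightarrow> real ^ 'c \<Rightarrow> real" where
  "first_order_term L T j e' =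
     gradient (unit_loss L T j) (T $ Some j) \<bullet> replacement_direction T j e'"

definition first_order_remainder ::
    "(('c::finite, 'n::finite) sequence \<Rightarrow> real) \<Rightarrow> ('c, 'n) sequence \<Rightarrow> 'n \<Rightarrow> real ^ 'c \<Rightarrow> real" where
  "first_order_remainder L T j e' = CEff_exact L T j e' - first_order_term L T j e'"

end

theory Submission
  imports Defs
begin

text \<open>
  Restricted to the segment from \<open>x\<close> to \<open>x + d\<close>, the function \<open>g t = f (x + t d)\<close> satisfies
  \<open>g'' t = (\<nabla>\<^sup>2 f (x + t d) d) \<bullet> d\<close>, which Cauchy-Schwarz bounds by \<open>H \<parallel>d\<parallel>\<^sup>2\<close>; the Lagrange
  remainder of order two does the rest. Continuity of the Hessian on the compact segment is what
  makes the supremum over the segment a genuine upper bound, as a real supremum of an unbounded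
  set would be a junk value.
\<close>

lemma norm_matrix_vector_mult_le_spectral_norm:
  "norm (A *v x) \<le> spectral_norm A * norm x"
  unfolding spectral_norm_def
  by (rule onorm) (rule matrix_vector_mul_bounded_linear)

text \<open>Every entry of \<open>A\<close> is at most \<open>norm A\<close> in absolute value. The
  factor is crude, but only finiteness matters: a bound on \<open>norm\<close> over a compact set
  becomes a bound on \<open>spectral_norm\<close>, so continuity of \<open>spectral_norm\<close>
  itself need not be proved.\<close>

lemma spectral_norm_le_norm:
  fixes A :: "real ^ 'm ^ 'n"
  shows "spectral_norm A \<le> real CARD('n) * real CARD('m) * norm A"
  unfolding spectral_norm_def
proof (rule onorm_le_matrix_component)
  show "\<bar>A $ i $ k\<bar> \<le> norm A" for i k
    by (meson component_le_norm_cart order_trans Finite_Cartesian_Product.norm_nth_le)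
qed

lemma bdd_above_spectral_norm_hessian:
  fixes f :: "real ^ 'c \<Rightarrow> real"
  assumes "C2_on U f" "compact S" "S \<subseteq> U"
  shows "bdd_above ((\<lambda>v. spectral_norm (hessian f v)) ` S)"
proof -
  have "compact (hessian f ` S)"
    using assms by (auto simp: C2_on_def intro: compact_continuous_image continuous_on_subset)
  then obtain B where B: "\<And>v. v \<in> S \<Longrightarrow> norm (hessian f v) \<le> B"
    by (meson compact_imp_bounded bounded_iff imageI)
  have "spectral_norm (hessian f v) \<le> real CARD('c) * real CARD('c) * B" if "v \<in> S" for v
    using spectral_norm_le_norm[of "hessian f v"] B[OF that]
    by (meson mult_left_mono order_trans mult_nonneg_nonneg of_nat_0_le_iff)
  then show ?thesis
    by (auto intro!: bdd_aboveI)
qed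

text \<open>Chain rule along the line through \<open>x\<close> in direction \<open>d\<close>. Both
  derivatives are two-sided at \<open>t\<close>, because \<open>C2_on\<close> gives full
  differentiability at every point of \<open>U\<close>; this covers the endpoints 0 and 1 of the
  parameter interval as well.\<close>

lemma C2_on_segment_derivatives:
  assumes "C2_on U f" "x + t *\<^sub>R d \<in> U"
  shows "((\<lambda>s. f (x + s *\<^sub>R d)) has_real_derivative gradient f (x + t *\<^sub>R d) \<bullet> d) (at t)"
    and "((\<lambda>s. gradient f (x + s *\<^sub>R d) \<bullet> d) has_real_derivative
           (hessian f (x + t *\<^sub>R d) *v d) \<bullet> d) (at t)"
proof -
  have line: "((\<lambda>s. x + s *\<^sub>R d) has_derivative (\<lambda>h. h *\<^sub>R d)) (at t)"
    by (auto intro!: derivative_eq_intros)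
  have "GDERIV f (x + t *\<^sub>R d) :> gradient f (x + t *\<^sub>R d)"
    using assms by (auto simp: C2_on_def intro: differentiable_GDERIV_gradient)
  then have "(f has_derivative (\<lambda>h. h \<bullet> gradient f (x + t *\<^sub>R d))) (at (x + t *\<^sub>R d))"
    by (simp add: gderiv_def)
  from has_derivative_compose[OF line this]
  show "((\<lambda>s. f (x + s *\<^sub>R d)) has_real_derivative gradient f (x + t *\<^sub>R d) \<bullet> d) (at t)"
    by (simp add: has_field_derivative_def inner_commute mult.commute[of _ "d \<bullet> _"])
  \<comment> \<open>The Hessian is the Jacobian of the gradient, so \<open>jacobian_works\<close>
    turns differentiability of the gradient into this matrix form.\<close>
  have "(gradient f has_derivative (*v) (hessian f (x + t *\<^sub>R d))) (at (x + t *\<^sub>R d))"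
    using assms by (simp add: C2_on_def hessian_def jacobian_works)
  from has_derivative_inner_left[OF has_derivative_compose[OF line this], of d]
  show "((\<lambda>s. gradient f (x + s *\<^sub>R d) \<bullet> d) has_real_derivative
           (hessian f (x + t *\<^sub>R d) *v d) \<bullet> d) (at t)"
    by (simp add: has_field_derivative_def matrix_vector_mult_scaleR mult.commute[of _ "_ \<bullet> d"])
qed

lemma first_order_taylor_bound:
  assumes C2: "C2_on U f" and seg: "closed_segment x (x + d) \<subseteq> U"
    and bound: "\<And>v. v \<in> closed_segment x (x + d) \<Longrightarrow> spectral_norm (hessian f v) \<le> H"
  shows "\<bar>f (x + d) - f x - gradient f x \<bullet> d\<bar> \<le> H / 2 * (norm d)\<^sup>2"
proof -
  \<comment> \<open>The derivative sequence that \<open>Maclaurin\<close> expects. Only the indices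
    0, 1 and 2 are used; derivatives are required for m < 2 only, so no third derivative of
    \<open>f\<close> enters.\<close>
  define D where "D m t = (if m = 0 then f (x + t *\<^sub>R d)
    else if m = Suc 0 then gradient f (x + t *\<^sub>R d) \<bullet> d
    else (hessian f (x + t *\<^sub>R d) *v d) \<bullet> d)" for m :: nat and t
  have in_seg: "x + t *\<^sub>R d \<in> closed_segment x (x + d)" if "0 \<le> t" "t \<le> 1" for t
    using that by (auto simp: closed_segment_def algebra_simps)
  have deriv: "\<forall>m t. m < 2 \<and> 0 \<le> t \<and> t \<le> 1 \<longrightarrow> DERIV (D m) t :> D (Suc m) t"
  proof (intro allI impI)
    fix m :: nat and t :: real
    assume "m < 2 \<and> 0 \<le> t \<and> t \<le> 1"
    then have m: "m = 0 \<or> m = Suc 0" and "x + t *\<^sub>R d \<in> U"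
      using in_seg seg by auto
    from C2_on_segment_derivatives[OF C2 this(2)] m
    show "DERIV (D m) t :> D (Suc m) t"
      by (auto simp: D_def[abs_def])
  qed
  \<comment> \<open>Expansion at 0 with step 1 and order 2: the sum is
    \<open>f x + gradient f x \<bullet> d\<close>, and \<open>fact 2\<close> in the remainder is the
    source of the factor 1/2.\<close>
  obtain t where t: "0 < t" "t < 1"
    and "f (x + 1 *\<^sub>R d) = (\<Sum>m<2. D m 0 / fact m * 1 ^ m) + D 2 t / fact 2 * 1 ^ 2"
    using Maclaurin[of 1 2 D "\<lambda>t. f (x + t *\<^sub>R d)", OF _ _ _ deriv]
    by (auto simp: D_def[abs_def])
  then have eq: "f (x + d) - f x - gradient f x \<bullet> d = (hessian f (x + t *\<^sub>R d) *v d) \<bullet> d / 2"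
    by (simp add: D_def numeral_2_eq_2)
  have "\<bar>(hessian f (x + t *\<^sub>R d) *v d) \<bullet> d\<bar> \<le> norm (hessian f (x + t *\<^sub>R d) *v d) * norm d"
    by (rule Cauchy_Schwarz_ineq2)
  also have "\<dots> \<le> spectral_norm (hessian f (x + t *\<^sub>R d)) * norm d * norm d"
    by (intro mult_right_mono norm_matrix_vector_mult_le_spectral_norm norm_ge_zero)
  also have "\<dots> \<le> H * norm d * norm d"
    using t by (intro mult_right_mono bound in_seg norm_ge_zero) auto
  finally show ?thesis
    unfolding eq by (simp add: power2_eq_square)
qed

theorem theorem1:
  fixes z :: "('c::finite, 'n::finite) sequence \<Rightarrow> real ^ 'k::finite"
    and T :: "('c, 'n) sequence"
    and y :: 'k
    and j :: 'n
    and e' :: "real ^ 'c"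
    and H :: real
  assumes predicted: "is_arg_max (\<lambda>k. z T $ k) (\<lambda>_. True) y"
    and smooth: "\<exists>U. replacement_segment T j e' \<subseteq> U \<and> C2_on U (unit_loss (saliency_loss z y) T j)"
    and hessian_bound:
      "(SUP v \<in> replacement_segment T j e'.
          spectral_norm (hessian (unit_loss (saliency_loss z y) T j) v)) \<le> H"
  shows "CEff_exact (saliency_loss z y) T j e' =
           first_order_term (saliency_loss z y) T j e' +
           first_order_remainder (saliency_loss z y) T j e'
       \<and> \<bar>first_order_remainder (saliency_loss z y) T j e'\<bar>
           \<le> H / 2 * (norm (replacement_direction T j e'))\<^sup>2
       \<and> \<bar>\<bar>CEff_exact (saliency_loss z y) T j e'\<bar> - \<bar>first_order_term (saliency_loss z y) T j e'\<bar>\<bar>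
           \<le> H / 2 * (norm (replacement_direction T j e'))\<^sup>2"
proof -
  let ?f = "unit_loss (saliency_loss z y) T j"
  let ?x = "T $ Some j"
  let ?d = "replacement_direction T j e'"
  have e': "?x + ?d = e'"
    by (simp add: replacement_direction_def)
  have seg: "replacement_segment T j e' = closed_segment ?x (?x + ?d)"
    by (simp add: e' replacement_segment_eq_closed_segment)
  obtain U where U: "closed_segment ?x (?x + ?d) \<subseteq> U" "C2_on U ?f"
    using smooth unfolding seg by blast
  \<comment> \<open>Passes from the bound on the supremum to a pointwise bound on the
    segment.\<close>
  have "spectral_norm (hessian ?f v) \<le> H" if "v \<in> closed_segment ?x (?x + ?d)" for v
    using cSUP_upper[OF that bdd_above_spectral_norm_hessian[OF U(2) compact_segment U(1)]]
      hessian_bound unfolding seg by linarith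
  from first_order_taylor_bound[OF U(2,1) this]
  have "\<bar>first_order_remainder (saliency_loss z y) T j e'\<bar> \<le> H / 2 * (norm ?d)\<^sup>2"
    by (simp add: first_order_remainder_def first_order_term_def CEff_exact_eq_unit_loss e')
  moreover have "CEff_exact (saliency_loss z y) T j e' =
      first_order_term (saliency_loss z y) T j e' + first_order_remainder (saliency_loss z y) T j e'"
    by (simp add: first_order_remainder_def)
  \<comment> \<open>The last conjunct is the reverse triangle inequality: the absolute values of a +
    R and a differ by at most that of R.\<close>
  ultimately show ?thesis
    by linarith
qed

end
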